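(* Let $\mathcal{V}$ be a finite-dimensional real vector space and let $\mathbf{P}$ be a random vector in $\mathcal{V}$ with finite support. If $\mathbf{C}$ is a survey of $\mathbf{P}$ and $\mathbf{D}$ is a survey of $\mathbf{C}$, then $\mathbf{D}$ is a survey of $\mathbf{P}$.
   Context: A skeleton in $\mathcal{V}$ is a tuple $(\mathcal{S},\alpha_1,\dots,\alpha_n)$ where $\mathcal{S}=(S_1,\dots,S_n)$ is a finite sequence of elements of $\mathcal{V}$ (the base set) and $\alpha_1,\dots,\alpha_n$ are functions from the convex hull $\mathrm{conv}(\mathcal{S})$ to $[0,1]$ such that for every $\eta\in\mathrm{conv}(\mathcal{S})$: $\sum_{i=1}^n\alpha_i(\eta)=1$ and $\eta=\sum_{i=1}^n\alpha_i(\eta)S_i$. If $\mathbf{P}$ is a random vector in $\mathcal{V}$ with finite support contained in $\mathrm{conv}(\mathcal{S})$, a survey of $\mathbf{P}$ on this skeleton is a random element $\mathbf{C}$ of $\mathcal{S}$ with $\mathbb{P}(\mathbf{C}=S_i)=\mathbb{E}[\alpha_i(\mathbf{P})]$ for $i=1,\dots,n$. $\mathbf{A}$ is called a survey of $\mathbf{B}$ if there exists some skeleton on which $\mathbf{A}$ is a survey of $\mathbf{B}$. *)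

theory Defs
  imports "HOL-Probability.Probability"
begin

text \<open>
  A random vector in a finite-dimensional real vector space: all its coordinates, in any basis,
  are real random variables. This needs no norm or topology on the space; on a Euclidean space
  it is Borel measurability, see \<open>random_vector_iff_borel\<close> below.
\<close>

definition random_vector :: "'a measure \<Rightarrow> ('a \<Rightarrow> 'v::real_vector) \<Rightarrow> bool" where
  "random_vector M X \<longleftrightarrow>
     prob_space M \<and> (\<forall>f :: 'v \<Rightarrow> real. linear f \<longrightarrow> (\<lambda>\<omega>. f (X \<omega>)) \<in> borel_measurable M)"

lemma random_vector_iff_borel:
  fixes X :: "'a \<Rightarrow> 'v::euclidean_space"
  shows "random_vector M X \<longleftrightarrow> prob_space M \<and> X \<in> borel_measurable M"
proof -
  have "(\<lambda>\<omega>. f (X \<omega>)) \<in> borel_measurable M"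
    if "X \<in> borel_measurable M" "linear f" for f :: "'v \<Rightarrow> real"
    using that by (metis borel_measurable_continuous_on linear_continuous_on linear_conv_bounded_linear)
  moreover have "X \<in> borel_measurable M"
    if "\<forall>f :: 'v \<Rightarrow> real. linear f \<longrightarrow> (\<lambda>\<omega>. f (X \<omega>)) \<in> borel_measurable M"
    using that bounded_linear.linear[OF bounded_linear_inner_left]
    by (subst borel_measurable_euclidean_space) auto
  ultimately show ?thesis
    unfolding random_vector_def by blast
qed

definition finite_support :: "'a measure \<Rightarrow> ('a \<Rightarrow> 'v) \<Rightarrow> bool" where
  "finite_support M X \<longleftrightarrow> (\<exists>F. finite F \<and> (AE \<omega> in M. X \<omega> \<in> F))"

definition rv_support :: "'a measure \<Rightarrow> ('a \<Rightarrow> 'v) \<Rightarrow> 'v set" where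
  "rv_support M X = {x. measure M {\<omega> \<in> space M. X \<omega> = x} > 0}"

text \<open>
  The values of \<open>\<alpha> i\<close> outside the convex hull, and \<open>\<alpha> i\<close> for \<open>i \<ge> length S\<close>, are irrelevant.
  Base points are indexed from 0 and may be repeated.
\<close>

definition skeleton :: "'v::real_vector list \<Rightarrow> (nat \<Rightarrow> 'v \<Rightarrow> real) \<Rightarrow> bool" where
  "skeleton S \<alpha> \<longleftrightarrow>
     (\<forall>i<length S. \<alpha> i \<in> convex hull (set S) \<rightarrow> {0..1}) \<and>
     (\<forall>\<eta>\<in>convex hull (set S).
        (\<Sum>i<length S. \<alpha> i \<eta>) = 1 \<and> \<eta> = (\<Sum>i<length S. \<alpha> i \<eta> *\<^sub>R S ! i))"

text \<open>
  A survey may live on another probability space than the surveyed vector. The expectation of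
  \<open>\<alpha> i (P \<omega>)\<close> is taken over the almost sure event that \<open>P\<close> lies in its support: off that event
  \<open>\<alpha> i (P \<omega>)\<close> may be undefined, and \<open>\<alpha> i\<close> itself need not be measurable.
\<close>

definition survey_on ::
  "'v::real_vector list \<Rightarrow> (nat \<Rightarrow> 'v \<Rightarrow> real) \<Rightarrow>
     'b measure \<Rightarrow> ('b \<Rightarrow> 'v) \<Rightarrow> 'a measure \<Rightarrow> ('a \<Rightarrow> 'v) \<Rightarrow> bool" where
  "survey_on S \<alpha> N C M P \<longleftrightarrow>
     random_vector M P \<and> finite_support M P \<and> rv_support M P \<subseteq> convex hull (set S) \<and>
     random_vector N C \<and> (AE \<omega> in N. C \<omega> \<in> set S) \<and>
     (\<forall>i<length S. measure N {\<omega> \<in> space N. C \<omega> = S ! i} =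
        (LINT \<omega>:{\<omega> \<in> space M. P \<omega> \<in> rv_support M P}|M. \<alpha> i (P \<omega>)))"

definition survey :: "'b measure \<Rightarrow> ('b \<Rightarrow> 'v::real_vector) \<Rightarrow> 'a measure \<Rightarrow> ('a \<Rightarrow> 'v) \<Rightarrow> bool" where
  "survey N C M P \<longleftrightarrow> (\<exists>S \<alpha>. skeleton S \<alpha> \<and> survey_on S \<alpha> N C M P)"

end

theory Submission
  imports Defs
begin

text \<open>
  Let \<open>C\<close> be a survey of \<open>P\<close> on \<open>(S, \<alpha>)\<close> and \<open>D\<close> a survey of \<open>C\<close> on \<open>(T, \<beta>)\<close>. If \<open>x\<close> is an atom
  of \<open>P\<close>, then every \<open>S ! i\<close> with \<open>\<alpha> i x > 0\<close> is an atom of \<open>C\<close> and so lies in the convex hull of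
  \<open>T\<close>. Hence \<open>\<gamma> j x = (\<Sum>i. \<alpha> i x * \<beta> j (S ! i))\<close> are convex weights of \<open>x\<close> over \<open>T\<close>, and
  averaging over \<open>P\<close> turns \<open>\<gamma> j\<close> into the average of \<open>\<beta> j\<close> over \<open>C\<close>. Off the atoms of \<open>P\<close> we
  keep \<open>\<gamma> j = \<beta> j\<close>, because \<open>\<beta> j (S ! i)\<close> is only controlled at atoms of \<open>C\<close>. A point repeated
  in \<open>S\<close> has probability 0 under \<open>C\<close>: the point probabilities prescribed at the \<open>S ! i\<close> sum to
  1 over all indices \<open>i\<close>, which leaves no room for counting an atom twice.
\<close>

section \<open>Atoms and expectations of finitely supported vectors\<close>

lemma linear_representation:
  fixes B :: "'v::real_vector set"
  assumes "independent B" "span B = UNIV"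
  shows "linear (\<lambda>v. real_vector.representation B v b)"
  using assms
  by (intro linearI) (auto simp: real_vector.representation_add real_vector.representation_scale)

text \<open>Measurability is given only through linear functionals. Equality with \<open>x\<close>
  amounts to equality of the coordinates in the finite basis \<open>B\<close>, hence to finitely
  many measurable conditions.\<close>

lemma random_vector_level_set:
  fixes X :: "'a \<Rightarrow> 'v::real_vector"
  assumes "finite_dimensional_vector_space (scaleR :: real \<Rightarrow> 'v \<Rightarrow> 'v) B"
    and X: "random_vector M X"
  shows "{\<omega> \<in> space M. X \<omega> = x} \<in> sets M"
proof -
  interpret fd: finite_dimensional_vector_space "scaleR :: real \<Rightarrow> 'v \<Rightarrow> 'v" B
    by fact
  have ind: "independent B" and sp: "span B = UNIV"
    using fd.independent_Basis fd.span_Basis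
    by (simp_all add: dependent_raw_def span_raw_def)
  define r where "r = (\<lambda>b v. real_vector.representation B v b)"
  have meas: "(\<lambda>\<omega>. r b (X \<omega>)) \<in> borel_measurable M" for b
    using X linear_representation[OF ind sp] unfolding random_vector_def r_def by blast
  have "(\<Sum>b\<in>B. r b v *\<^sub>R b) = v" for v
    unfolding r_def using ind sp fd.finite_Basis
    by (intro real_vector.sum_representation_eq) auto
  then have "X \<omega> = x \<longleftrightarrow> (\<forall>b\<in>B. r b (X \<omega>) = r b x)" for \<omega>
    by (metis (no_types, lifting) sum.cong)
  moreover have "{\<omega> \<in> space M. \<forall>b\<in>B. r b (X \<omega>) = r b x} \<in> sets M"
    using fd.finite_Basis meas by measurable
  ultimately show ?thesis by simp
qed

lemma rv_support_subset:
  assumes "AE \<omega> in M. X \<omega> \<in> F"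
  shows "rv_support M X \<subseteq> F"
proof
  fix x assume "x \<in> rv_support M X"
  then have pos: "measure M {\<omega> \<in> space M. X \<omega> = x} > 0" (is "measure M ?A > 0")
    by (simp add: rv_support_def)
  \<comment> \<open>\<open>measure\<close> takes the default value 0 outside the sigma-algebra, so
    positivity already yields measurability.\<close>
  then have A: "?A \<in> sets M" using measure_notin_sets by fastforce
  show "x \<in> F"
  proof (rule ccontr)
    assume "x \<notin> F"
    then have "AE \<omega> in M. X \<omega> \<noteq> x" using assms by (auto elim: eventually_mono)
    then have "emeasure M ?A = 0" by (subst (asm) AE_iff_measurable[OF A]) auto
    then show False using pos by (simp add: measure_def)
  qed
qed

lemma finite_rv_support:
  assumes "finite_support M X"
  shows "finite (rv_support M X)"
  using assms rv_support_subset finite_subset unfolding finite_support_def by metis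

text \<open>Only finitely many values in \<open>F\<close> can fail to be atoms, and each of them has
  a null level set.\<close>

lemma AE_rv_support:
  assumes "finite_support M X" "prob_space M"
    and meas: "\<And>x. {\<omega> \<in> space M. X \<omega> = x} \<in> sets M"
  shows "AE \<omega> in M. X \<omega> \<in> rv_support M X"
proof -
  interpret prob_space M by fact
  obtain F where F: "finite F" "AE \<omega> in M. X \<omega> \<in> F"
    using assms unfolding finite_support_def by blast
  have "AE \<omega> in M. X \<omega> \<noteq> x" if "x \<notin> rv_support M X" for x
  proof -
    have "measure M {\<omega> \<in> space M. X \<omega> = x} = 0"
      using that by (simp add: rv_support_def not_less measure_le_0_iff)
    then have "emeasure M {\<omega> \<in> space M. \<not> X \<omega> \<noteq> x} = 0"
      by (simp add: emeasure_eq_measure)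
    then show ?thesis by (subst AE_iff_measurable[OF _ refl]) (use meas in auto)
  qed
  then have "AE \<omega> in M. \<forall>x\<in>F - rv_support M X. X \<omega> \<noteq> x"
    using F(1) by (intro AE_finite_allI) auto
  then show ?thesis using F(2) by eventually_elim auto
qed

text \<open>On the event of integration \<open>f (X \<omega>)\<close> is a finite combination of
  indicators of level sets, so the values of \<open>f\<close> enter only as constants. This suits
  the arbitrary weight functions of a skeleton.\<close>

lemma set_integral_rv_support:
  fixes f :: "'v \<Rightarrow> real"
  assumes fin: "finite (rv_support M X)" and "prob_space M"
    and meas: "\<And>x. {\<omega> \<in> space M. X \<omega> = x} \<in> sets M"
  shows "(LINT \<omega>:{\<omega> \<in> space M. X \<omega> \<in> rv_support M X}|M. f (X \<omega>)) =
    (\<Sum>x\<in>rv_support M X. measure M {\<omega> \<in> space M. X \<omega> = x} * f x)"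
proof -
  interpret prob_space M by fact
  let ?R = "rv_support M X"
  have eq: "indicator {\<omega> \<in> space M. X \<omega> \<in> ?R} \<omega> *\<^sub>R f (X \<omega>) =
      (\<Sum>x\<in>?R. indicator {\<omega> \<in> space M. X \<omega> = x} \<omega> * f x)" if "\<omega> \<in> space M" for \<omega>
  proof (cases "X \<omega> \<in> ?R")
    case True
    have "(\<Sum>x\<in>?R. indicator {\<omega> \<in> space M. X \<omega> = x} \<omega> * f x) =
        (\<Sum>x\<in>?R. if X \<omega> = x then f x else 0)"
      using that by (intro sum.cong) (auto simp: indicator_def)
    then show ?thesis using True that fin by simp
  next
    case False
    then have "(\<Sum>x\<in>?R. indicator {\<omega> \<in> space M. X \<omega> = x} \<omega> * f x) = 0"
      by (intro sum.neutral) (auto simp: indicator_def)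
    then show ?thesis using False by simp
  qed
  have "(LINT \<omega>:{\<omega> \<in> space M. X \<omega> \<in> ?R}|M. f (X \<omega>)) =
      (\<integral>\<omega>. (\<Sum>x\<in>?R. indicator {\<omega> \<in> space M. X \<omega> = x} \<omega> * f x) \<partial>M)"
    unfolding set_lebesgue_integral_def by (intro Bochner_Integration.integral_cong refl eq)
  also have "\<dots> = (\<Sum>x\<in>?R. \<integral>\<omega>. indicator {\<omega> \<in> space M. X \<omega> = x} \<omega> * f x \<partial>M)"
    by (intro Bochner_Integration.integral_sum integrable_mult_left integrable_real_indicator meas)
      (simp add: emeasure_eq_measure)
  also have "\<dots> = (\<Sum>x\<in>?R. measure M {\<omega> \<in> space M. X \<omega> = x} * f x)"
    by (intro sum.cong refl) (simp add: Int_absorb2 subset_iff)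
  finally show ?thesis .
qed

section \<open>Total mass and repeated base points\<close>

lemma sum_prob_eq_1:
  assumes "finite F" "prob_space M" and AE: "AE \<omega> in M. X \<omega> \<in> F"
    and meas: "\<And>x. {\<omega> \<in> space M. X \<omega> = x} \<in> sets M"
  shows "(\<Sum>x\<in>F. measure M {\<omega> \<in> space M. X \<omega> = x}) = 1"
proof -
  interpret prob_space M by fact
  have "(\<Sum>x\<in>F. measure M {\<omega> \<in> space M. X \<omega> = x}) = prob (\<Union>x\<in>F. {\<omega> \<in> space M. X \<omega> = x})"
    by (rule finite_measure_finite_Union[symmetric])
      (use assms in \<open>auto simp: disjoint_family_on_def\<close>)
  also have "\<dots> = 1"
    by (subst prob_eq_1) (use assms in \<open>auto elim: eventually_mono\<close>)
  finally show ?thesis .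
qed

text \<open>If \<open>y\<close> occurs \<open>m y\<close> times in \<open>S\<close>, the index sum
  exceeds the set sum by the sum of the terms \<open>(m y - 1) * c y\<close>. These are nonnegative,
  so \<open>le\<close> makes each vanish: \<open>c y = 0\<close> wherever
  \<open>m y > 1\<close>.\<close>

lemma sum_nth_eq_sum_set:
  fixes c g :: "'v \<Rightarrow> real"
  assumes nonneg: "\<And>y. y \<in> set S \<Longrightarrow> 0 \<le> c y"
    and le: "(\<Sum>i<length S. c (S ! i)) \<le> (\<Sum>y\<in>set S. c y)"
  shows "(\<Sum>i<length S. c (S ! i) * g (S ! i)) = (\<Sum>y\<in>set S. c y * g y)"
proof -
  define m where "m y = card {i. i < length S \<and> S ! i = y}" for y
  have group: "(\<Sum>i<length S. f (S ! i)) = (\<Sum>y\<in>set S. real (m y) * f y)" for f :: "'v \<Rightarrow> real"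
  proof -
    have "(\<Sum>i<length S. f (S ! i)) = (\<Sum>y\<in>set S. \<Sum>i\<in>{i\<in>{..<length S}. S ! i = y}. f (S ! i))"
      by (rule sum.group[symmetric]) auto
    also have "\<dots> = (\<Sum>y\<in>set S. real (m y) * f y)"
      by (intro sum.cong refl) (simp add: m_def)
    finally show ?thesis .
  qed
  have m1: "real (m y) \<ge> 1" if "y \<in> set S" for y
  proof -
    have "{i. i < length S \<and> S ! i = y} \<noteq> {}" using that by (auto simp: in_set_conv_nth)
    then have "m y > 0" unfolding m_def by (subst card_gt_0_iff) auto
    then show ?thesis by simp
  qed
  have excess_nonneg: "(real (m y) - 1) * c y \<ge> 0" if "y \<in> set S" for y
    using m1[OF that] nonneg[OF that] by simp
  have "(\<Sum>y\<in>set S. (real (m y) - 1) * c y) \<le> 0"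
    using le unfolding group by (simp add: algebra_simps sum_subtractf)
  then have "(\<Sum>y\<in>set S. (real (m y) - 1) * c y) = 0"
    using sum_nonneg[of "set S" "\<lambda>y. (real (m y) - 1) * c y"] excess_nonneg by force
  then have "(real (m y) - 1) * c y = 0" if "y \<in> set S" for y
    using that excess_nonneg by (subst (asm) sum_nonneg_eq_0_iff) auto
  then have "real (m y) * (c y * g y) = c y * g y" if "y \<in> set S" for y
    using that by (auto simp: algebra_simps)
  then show ?thesis unfolding group[of "\<lambda>y. c y * g y"] by (intro sum.cong) auto
qed

section \<open>Composition of two skeletons\<close>

lemma skeletonD:
  assumes "skeleton S \<alpha>" "\<eta> \<in> convex hull set S"
  shows "i < length S \<Longrightarrow> \<alpha> i \<eta> \<in> {0..1}"
    and "(\<Sum>i<length S. \<alpha> i \<eta>) = 1"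
    and "(\<Sum>i<length S. \<alpha> i \<eta> *\<^sub>R S ! i) = \<eta>"
proof -
  show "\<alpha> i \<eta> \<in> {0..1}" if "i < length S"
    using assms that unfolding skeleton_def by blast
  have "(\<Sum>i<length S. \<alpha> i \<eta>) = 1 \<and> \<eta> = (\<Sum>i<length S. \<alpha> i \<eta> *\<^sub>R S ! i)"
    using assms unfolding skeleton_def by (elim conjE) (drule (1) bspec)
  then show "(\<Sum>i<length S. \<alpha> i \<eta>) = 1" "(\<Sum>i<length S. \<alpha> i \<eta> *\<^sub>R S ! i) = \<eta>"
    by simp_all
qed

theorem theorem2:
  fixes B :: "'v::real_vector set"
    and M :: "'a measure" and P :: "'a \<Rightarrow> 'v"
    and N :: "'b measure" and C :: "'b \<Rightarrow> 'v"
    and L :: "'c measure" and D :: "'c \<Rightarrow> 'v"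
  assumes "finite_dimensional_vector_space (scaleR :: real \<Rightarrow> 'v \<Rightarrow> 'v) B"
    and "random_vector M P" and "finite_support M P"
    and "survey N C M P"
    and "survey L D N C"
  shows "survey L D M P"
proof -
  obtain S \<alpha> where sk1: "skeleton S \<alpha>" and s1: "survey_on S \<alpha> N C M P"
    using assms unfolding survey_def by blast
  obtain T \<beta> where sk2: "skeleton T \<beta>" and s2: "survey_on T \<beta> L D N C"
    using assms unfolding survey_def by blast
  define p where "p x = measure M {\<omega> \<in> space M. P \<omega> = x}" for x
  define c where "c y = measure N {\<omega> \<in> space N. C \<omega> = y}" for y
  define RP where "RP = rv_support M P"
  define RC where "RC = rv_support N C"
  let ?n = "length S"
  have psM: "prob_space M" and psN: "prob_space N"
    using s1 unfolding survey_on_def random_vector_def by blast+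
  have mP: "{\<omega> \<in> space M. P \<omega> = x} \<in> sets M" for x
    using random_vector_level_set assms(1,2) by blast
  have mC: "{\<omega> \<in> space N. C \<omega> = x} \<in> sets N" for x
    using random_vector_level_set assms(1) s1 unfolding survey_on_def by blast
  have finC: "finite_support N C" using s2 unfolding survey_on_def by blast
  have fRP: "finite RP" and fRC: "finite RC"
    unfolding RP_def RC_def using finite_rv_support assms(3) finC by blast+
  have RP_S: "RP \<subseteq> convex hull set S" and RC_T: "RC \<subseteq> convex hull set T"
    using s1 s2 unfolding survey_on_def RP_def RC_def by blast+
  have p_pos: "p x > 0" if "x \<in> RP" for x using that by (simp add: p_def RP_def rv_support_def)
  have c_nonneg: "c y \<ge> 0" for y by (simp add: c_def)
  have c_zero: "c y = 0" if "y \<notin> RC" for y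
    using that c_nonneg[of y] unfolding RC_def rv_support_def c_def mem_Collect_eq not_less
    by (rule antisym)
  have EP: "(LINT \<omega>:{\<omega> \<in> space M. P \<omega> \<in> rv_support M P}|M. f (P \<omega>)) = (\<Sum>x\<in>RP. p x * f x)"
    for f :: "'v \<Rightarrow> real"
    using set_integral_rv_support[OF fRP[unfolded RP_def] psM mP] by (simp add: RP_def p_def)
  have EC: "(LINT \<omega>:{\<omega> \<in> space N. C \<omega> \<in> rv_support N C}|N. f (C \<omega>)) = (\<Sum>y\<in>RC. c y * f y)"
    for f :: "'v \<Rightarrow> real"
    using set_integral_rv_support[OF fRC[unfolded RC_def] psN mC] by (simp add: RC_def c_def)
  have cS: "c (S ! i) = (\<Sum>x\<in>RP. p x * \<alpha> i x)" if "i < ?n" for i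
    using s1 that EP[of "\<alpha> i"] unfolding survey_on_def c_def by simp
  have \<alpha>_nonneg: "\<alpha> i x \<ge> 0" if "i < ?n" "x \<in> RP" for i x
    using skeletonD(1)[OF sk1 subsetD[OF RP_S that(2)] that(1)] by simp
  have \<alpha>_sum: "(\<Sum>i<?n. \<alpha> i x) = 1" "(\<Sum>i<?n. \<alpha> i x *\<^sub>R S ! i) = x" if "x \<in> RP" for x
    using skeletonD(2,3)[OF sk1 subsetD[OF RP_S that]] by simp_all
  \<comment> \<open>Here \<open>c (S ! i) = 0\<close> is a sum of nonnegative terms
    \<open>p x * \<alpha> i x\<close>, and every \<open>p x\<close> is positive.\<close>
  have \<alpha>_zero: "\<alpha> i x = 0" if "i < ?n" "x \<in> RP" "S ! i \<notin> RC" for i x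
  proof -
    have "(\<Sum>x\<in>RP. p x * \<alpha> i x) = 0" using cS[OF that(1)] c_zero[OF that(3)] by simp
    then have "p x * \<alpha> i x = 0"
      using that fRP p_pos \<alpha>_nonneg by (subst (asm) sum_nonneg_eq_0_iff) (auto simp: less_imp_le)
    then show ?thesis using p_pos[OF that(2)] by simp
  qed
  \<comment> \<open>For these indices \<open>S ! i\<close> lies in the hull of \<open>T\<close>,
    where the \<open>\<beta> j\<close> are known to be convex weights.\<close>
  define I where "I = {i. i < ?n \<and> S ! i \<in> RC}"
  have I: "finite I" "I \<subseteq> {..<?n}" by (auto simp: I_def)
  have \<alpha>_I: "(\<Sum>i\<in>I. \<alpha> i x) = 1" "(\<Sum>i\<in>I. \<alpha> i x *\<^sub>R S ! i) = x"
    "(\<Sum>i<?n. \<alpha> i x * f i) = (\<Sum>i\<in>I. \<alpha> i x * f i)"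
    if "x \<in> RP" for x and f :: "nat \<Rightarrow> real"
  proof -
    have "(\<Sum>i\<in>I. \<alpha> i x) = (\<Sum>i<?n. \<alpha> i x)"
      using that I \<alpha>_zero by (intro sum.mono_neutral_left) (auto simp: I_def)
    then show "(\<Sum>i\<in>I. \<alpha> i x) = 1" using \<alpha>_sum that by simp
    have "(\<Sum>i\<in>I. \<alpha> i x *\<^sub>R S ! i) = (\<Sum>i<?n. \<alpha> i x *\<^sub>R S ! i)"
      using that I \<alpha>_zero by (intro sum.mono_neutral_left) (auto simp: I_def)
    then show "(\<Sum>i\<in>I. \<alpha> i x *\<^sub>R S ! i) = x" using \<alpha>_sum(2)[OF that] by simp
    show "(\<Sum>i<?n. \<alpha> i x * f i) = (\<Sum>i\<in>I. \<alpha> i x * f i)"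
      using that I \<alpha>_zero by (intro sum.mono_neutral_right) (auto simp: I_def)
  qed
  have \<alpha>_I_nonneg: "\<alpha> i x \<ge> 0" if "i \<in> I" "x \<in> RP" for i x
    using \<alpha>_nonneg that by (simp add: I_def)
  have SI: "S ! i \<in> convex hull set T" if "i \<in> I" for i
    using that RC_T by (auto simp: I_def)
  have RP_T: "RP \<subseteq> convex hull set T"
  proof
    fix x assume x: "x \<in> RP"
    have "(\<Sum>i\<in>I. \<alpha> i x *\<^sub>R S ! i) \<in> convex hull set T"
      using I x \<alpha>_I SI \<alpha>_I_nonneg by (intro convex_sum) auto
    then show "x \<in> convex hull set T" using \<alpha>_I(2)[OF x] by simp
  qed
  \<comment> \<open>The sum over all indices fits the expectation formula \<open>cS\<close>; the
    equal sum over \<open>I\<close> is the one used for the skeleton conditions.\<close>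
  define \<gamma> where "\<gamma> j x = (if x \<in> RP then \<Sum>i<?n. \<alpha> i x * \<beta> j (S ! i) else \<beta> j x)" for j x
  have \<gamma>: "\<gamma> j x = (\<Sum>i\<in>I. \<alpha> i x * \<beta> j (S ! i))" if "x \<in> RP" for j x
    using \<alpha>_I(3)[OF that] that by (simp add: \<gamma>_def)
  note \<beta>01 = skeletonD(1)[OF sk2] and \<beta>_sum = skeletonD(2,3)[OF sk2]
  have "skeleton T \<gamma>"
    unfolding skeleton_def
  proof (intro conjI allI impI ballI funcsetI)
    fix j x assume j: "j < length T" and x: "x \<in> convex hull set T"
    show "\<gamma> j x \<in> {0..1}"
    proof (cases "x \<in> RP")
      case True
      \<comment> \<open>The unit interval is convex, and on the reals scaling is
        multiplication.\<close>
      have "(\<Sum>i\<in>I. \<alpha> i x *\<^sub>R \<beta> j (S ! i)) \<in> {0..1}"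
        using I True \<alpha>_I \<alpha>_I_nonneg \<beta>01[OF SI j] by (intro convex_sum) auto
      then show ?thesis using \<gamma>[OF True] by simp
    qed (use \<beta>01 j x in \<open>simp add: \<gamma>_def\<close>)
  next
    fix x assume x: "x \<in> convex hull set T"
    show "(\<Sum>j<length T. \<gamma> j x) = 1"
    proof (cases "x \<in> RP")
      case True
      have "(\<Sum>j<length T. \<gamma> j x) = (\<Sum>i\<in>I. \<Sum>j<length T. \<alpha> i x * \<beta> j (S ! i))"
        unfolding \<gamma>[OF True] by (rule sum.swap)
      also have "\<dots> = (\<Sum>i\<in>I. \<alpha> i x)"
        by (intro sum.cong refl) (simp add: SI \<beta>_sum flip: sum_distrib_left)
      finally show ?thesis using \<alpha>_I True by simp
    qed (use \<beta>_sum x in \<open>simp add: \<gamma>_def\<close>)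
    show "x = (\<Sum>j<length T. \<gamma> j x *\<^sub>R T ! j)"
    proof (cases "x \<in> RP")
      case True
      \<comment> \<open>After the swap, the inner sum rebuilds \<open>S ! i\<close> from
        \<open>T\<close>, and the outer one rebuilds \<open>x\<close> from \<open>S\<close>.\<close>
      have "(\<Sum>j<length T. \<gamma> j x *\<^sub>R T ! j) =
          (\<Sum>i\<in>I. \<Sum>j<length T. \<alpha> i x *\<^sub>R \<beta> j (S ! i) *\<^sub>R T ! j)"
        unfolding \<gamma>[OF True] scaleR_left.sum by (subst sum.swap) simp
      also have "\<dots> = (\<Sum>i\<in>I. \<alpha> i x *\<^sub>R S ! i)"
        by (intro sum.cong refl) (simp only: scaleR_right.sum[symmetric] \<beta>_sum(2)[OF SI])
      finally show ?thesis using \<alpha>_I True by simp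
    qed (use \<beta>_sum x in \<open>simp add: \<gamma>_def\<close>)
  qed
  moreover have "survey_on T \<gamma> L D M P"
  proof -
    \<comment> \<open>Both totals are 1: over indices because the weights at each atom of
      \<open>P\<close> sum to 1, over \<open>set S\<close> because \<open>C\<close> almost surely
      lies there.\<close>
    have "(\<Sum>i<?n. c (S ! i)) = (\<Sum>i<?n. \<Sum>x\<in>RP. p x * \<alpha> i x)"
      using cS by simp
    also have "\<dots> = (\<Sum>x\<in>RP. \<Sum>i<?n. p x * \<alpha> i x)" by (rule sum.swap)
    also have "\<dots> = (\<Sum>x\<in>RP. p x)"
      by (intro sum.cong refl) (simp add: \<alpha>_sum flip: sum_distrib_left)
    also have "\<dots> = 1"
      unfolding p_def using AE_rv_support[OF assms(3) psM mP]
      by (intro sum_prob_eq_1 fRP psM mP) (simp add: RP_def)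
    also have "1 = (\<Sum>y\<in>set S. c y)"
      unfolding c_def using s1
      by (intro sum_prob_eq_1[symmetric] psN mC) (simp_all add: survey_on_def)
    finally have total: "(\<Sum>i<?n. c (S ! i)) \<le> (\<Sum>y\<in>set S. c y)" by simp
    have RC_S: "RC \<subseteq> set S"
      unfolding RC_def using s1 by (intro rv_support_subset) (simp add: survey_on_def)
    have key: "(\<Sum>x\<in>RP. p x * \<gamma> j x) = (\<Sum>y\<in>RC. c y * \<beta> j y)" for j
    proof -
      have "(\<Sum>x\<in>RP. p x * \<gamma> j x) = (\<Sum>x\<in>RP. \<Sum>i<?n. p x * \<alpha> i x * \<beta> j (S ! i))"
        by (intro sum.cong refl) (simp add: \<gamma>_def sum_distrib_left mult.assoc)
      also have "\<dots> = (\<Sum>i<?n. \<Sum>x\<in>RP. p x * \<alpha> i x * \<beta> j (S ! i))" by (rule sum.swap)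
      also have "\<dots> = (\<Sum>i<?n. c (S ! i) * \<beta> j (S ! i))"
        by (intro sum.cong refl) (simp add: cS sum_distrib_right)
      \<comment> \<open>This passage from indices to points would fail if a repeated point had
        positive probability; \<open>total\<close> excludes that.\<close>
      also have "\<dots> = (\<Sum>y\<in>set S. c y * \<beta> j y)"
        using sum_nth_eq_sum_set[OF c_nonneg total] .
      also have "\<dots> = (\<Sum>y\<in>RC. c y * \<beta> j y)"
        using RC_S c_zero by (intro sum.mono_neutral_right) auto
      finally show ?thesis .
    qed
    have "measure L {\<omega> \<in> space L. D \<omega> = T ! j} =
        (LINT \<omega>:{\<omega> \<in> space M. P \<omega> \<in> rv_support M P}|M. \<gamma> j (P \<omega>))" if "j < length T" for j
      using s2 that unfolding survey_on_def EP EC key by blast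
    then show ?thesis
      using s2 assms(2,3) RP_T unfolding survey_on_def RP_def by blast
  qed
  ultimately show ?thesis unfolding survey_def by blast
qed

end
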